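(* Let $(\widehat{\mathit{Init}},\widehat{\delta},\widehat{\mathit{Bad}})$ be obtained as the instrumentation of a transition system $(\mathit{Init},\delta,\mathit{Bad})$ over $\Sigma$ by a variable $q\notin\Sigma$ capturing a formula $\psi$ over $\Sigma$. Let $I$ be a formula over $\Sigma$ that is an inductive invariant for $(\mathit{Init},\delta,\mathit{Bad})$. Then (even if $I$ is also an inductive invariant for $(\widehat{\mathit{Init}},\widehat{\delta},\widehat{\mathit{Bad}})$) $I$ is not forwards $k$-fenced in $(\widehat{\mathit{Init}},\widehat{\delta},\widehat{\mathit{Bad}})$ for any $k\in\mathbb{N}$; that is, for every $k\in\mathbb{N}$, $\partial^+(I)\not\subseteq\widehat{\delta}^{\le k}(\widehat{\mathit{Init}})$, where $I$ and its boundary are taken over the vocabulary $\widehat{\Sigma}=\Sigma\uplus\{q\}$.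
   Context: Transition systems. $\Sigma$ is a finite set of Boolean variables; a state is a valuation of $\Sigma$; a formula over $\Sigma$ is identified with the set of states satisfying it, and $\varphi\Longrightarrow\psi$ means that $\varphi\to\psi$ is valid. A transition system is a triple $(\mathit{Init},\delta,\mathit{Bad})$ with $\mathit{Init},\mathit{Bad}$ formulas over $\Sigma$ and $\delta$ a formula over $\Sigma\uplus\Sigma'$ ($\Sigma'$ a primed copy), describing pairs (pre-state, post-state). Standing assumptions: $\mathit{Init}\not\equiv\mathit{false}$, $\mathit{Bad}\not\equiv\mathit{true},\mathit{false}$, $\mathit{Init}\Longrightarrow\neg\mathit{Bad}$. An inductive invariant is a formula $I$ with (i) $\mathit{Init}\Longrightarrow I$, (ii) $I\wedge\delta\Longrightarrow I'$, (iii) $I\Longrightarrow\neg\mathit{Bad}$, where $I'$ is $I$ with variables primed. $\delta^{\le k}(S)$ is the set of states reachable from some state in $S$ in at most $k$ steps of $\delta$. Two states are neighbors if they differ in exactly one variable. $\partial^+(I)=\{\sigma\models I : \sigma\text{ has a neighbor }\not\models I\}$. $I$ is forwards $k$-fenced in $(\mathit{Init},\delta,\mathit{Bad})$ if $\partial^+(I)\subseteq\delta^{\le k}(\mathit{Init})$. Instrumentation by a derived relation. The vocabulary is extended to $\widehat{\Sigma}=\Sigma\uplus\{q\}$, and the new system $(\widehat{\mathit{Init}},\widehat{\delta},\widehat{\mathit{Bad}})$ over $\widehat\Sigma$ satisfies: $\widehat{\mathit{Init}}\equiv\mathit{Init}\wedge(q\leftrightarrow\psi)$; if $q$ has the correct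 interpretation in the pre-state then $\widehat\delta$ performs a step of $\delta$ and correctly updates $q$, i.e. $\widehat\delta\wedge(q\leftrightarrow\psi)\Longrightarrow\delta\wedge(q'\leftrightarrow\psi')$; $\widehat{\mathit{Bad}}\Longrightarrow\mathit{Bad}$, and the projection of $\widehat{\mathit{Bad}}$ to $\Sigma$ is exactly $\mathit{Bad}$. *)

theory Defs
  imports Main "HOL-Library.FuncSet"
begin

text \<open>
  A state over a vocabulary \<open>V\<close> is a valuation of \<open>V\<close>, i.e. an extensional function in
  \<open>V \<rightarrow>\<^sub>E UNIV\<close>. Formulas are identified with sets of states, and a formula over
  a vocabulary and its primed copy with a set of pairs (pre-state, post-state).
\<close>

type_synonym 'v state = "'v \<Rightarrow> bool"
type_synonym 'v formula = "'v state set"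
type_synonym 'v formula2 = "('v state \<times> 'v state) set"
type_synonym 'v ts = "'v formula \<times> 'v formula2 \<times> 'v formula"

definition states :: "'v set \<Rightarrow> 'v state set" where
  "states V = V \<rightarrow>\<^sub>E (UNIV :: bool set)"

fun transition_system :: "'v set \<Rightarrow> 'v ts \<Rightarrow> bool" where
  "transition_system V (Init, \<delta>, Bad) \<longleftrightarrow>
     finite V \<and> Init \<subseteq> states V \<and> \<delta> \<subseteq> states V \<times> states V \<and> Bad \<subseteq> states V \<and>
     Init \<noteq> {} \<and> Bad \<noteq> states V \<and> Bad \<noteq> {} \<and> Init \<subseteq> states V - Bad"

fun inductive_invariant :: "'v set \<Rightarrow> 'v ts \<Rightarrow> 'v formula \<Rightarrow> bool" where
  "inductive_invariant V (Init, \<delta>, Bad) I \<longleftrightarrow>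
     I \<subseteq> states V \<and> Init \<subseteq> I \<and>
     (\<forall>(s, s') \<in> \<delta>. s \<in> I \<longrightarrow> s' \<in> I) \<and>
     I \<subseteq> states V - Bad"

definition reach_le :: "'v formula2 \<Rightarrow> nat \<Rightarrow> 'v formula \<Rightarrow> 'v formula" where
  "reach_le \<delta> k S = (\<Union>j\<le>k. (\<delta> ^^ j) `` S)"

definition neighbors :: "'v set \<Rightarrow> 'v state \<Rightarrow> 'v state \<Rightarrow> bool" where
  "neighbors V s t \<longleftrightarrow> s \<in> states V \<and> t \<in> states V \<and> (\<exists>!v. v \<in> V \<and> s v \<noteq> t v)"

definition inner_boundary :: "'v set \<Rightarrow> 'v formula \<Rightarrow> 'v formula" where
  "inner_boundary V I = {s \<in> I. \<exists>t. neighbors V s t \<and> t \<notin> I}"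

fun forwards_fenced :: "'v set \<Rightarrow> nat \<Rightarrow> 'v ts \<Rightarrow> 'v formula \<Rightarrow> bool" where
  "forwards_fenced V k (Init, \<delta>, Bad) I \<longleftrightarrow> inner_boundary V I \<subseteq> reach_le \<delta> k Init"

text \<open>
  A formula over \<open>V\<close> read as a formula over a larger vocabulary \<open>W\<close> that constrains
  only the variables in \<open>V\<close>.
\<close>

definition lift_formula :: "'v set \<Rightarrow> 'v set \<Rightarrow> 'v formula \<Rightarrow> 'v formula" where
  "lift_formula V W \<phi> = {s \<in> states W. restrict s V \<in> \<phi>}"

definition lift_formula2 :: "'v set \<Rightarrow> 'v set \<Rightarrow> 'v formula2 \<Rightarrow> 'v formula2" where
  "lift_formula2 V W \<delta> =
     {(s, s') \<in> states W \<times> states W. (restrict s V, restrict s' V) \<in> \<delta>}"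

text \<open>The formula \<open>q \<leftrightarrow> \<psi>\<close> over \<open>V\<close> extended by \<open>q\<close>.\<close>

definition captures :: "'v set \<Rightarrow> 'v \<Rightarrow> 'v formula \<Rightarrow> 'v formula" where
  "captures V q \<psi> =
     {s \<in> states (insert q V). s q \<longleftrightarrow> s \<in> lift_formula V (insert q V) \<psi>}"

text \<open>
  The last conjunct is the projection condition: projecting a formula to \<open>V\<close>
  quantifies \<open>q\<close> existentially, i.e. restricts all its states to \<open>V\<close>.
\<close>

fun instrumentation :: "'v set \<Rightarrow> 'v ts \<Rightarrow> 'v \<Rightarrow> 'v formula \<Rightarrow> 'v ts \<Rightarrow> bool" where
  "instrumentation V (Init, \<delta>, Bad) q \<psi> (Init_hat, \<delta>_hat, Bad_hat) \<longleftrightarrow>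
     Init_hat \<subseteq> states (insert q V) \<and>
     \<delta>_hat \<subseteq> states (insert q V) \<times> states (insert q V) \<and>
     Bad_hat \<subseteq> states (insert q V) \<and>
     Init_hat = lift_formula V (insert q V) Init \<inter> captures V q \<psi> \<and>
     (\<forall>(s, s') \<in> \<delta>_hat. s \<in> captures V q \<psi> \<longrightarrow>
        (s, s') \<in> lift_formula2 V (insert q V) \<delta> \<and> s' \<in> captures V q \<psi>) \<and>
     Bad_hat \<subseteq> lift_formula V (insert q V) Bad \<and>
     (\<lambda>s. restrict s V) ` Bad_hat = Bad"

end

theory Submission
  imports Defs
begin

text \<open>
  All states reachable in the instrumented system interpret \<open>q\<close> correctly. The hypercube
  is connected and \<open>I\<close> is neither empty nor valid, so \<open>I\<close> has a boundary state over the
  original vocabulary; extending it with the wrong value of \<open>q\<close> gives a boundary state over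
  the larger vocabulary that is never reached.
\<close>

text \<open>Walk from \<open>s\<close> to \<open>t\<close>, flipping one differing variable at a
  time. The walk starts inside \<open>I\<close> and ends outside, so some flip leaves
  \<open>I\<close>, and the state just before that flip is on the boundary.\<close>

lemma inner_boundary_nonempty:
  assumes "finite V" "I \<subseteq> states V" "s \<in> I" "t \<in> states V" "t \<notin> I"
  shows "inner_boundary V I \<noteq> {}"
proof -
  \<comment> \<open>Induction on the set \<open>D\<close> of variables still to be flipped;
    \<open>s\<close> varies because it is the current position of the walk, while \<open>t\<close>
    stays fixed.\<close>
  have "inner_boundary V I \<noteq> {}"
    if "finite D" "D = {v \<in> V. s v \<noteq> t v}" "s \<in> I" for D s
    using that
  proof (induction D arbitrary: s rule: finite_induct)
    case empty
    have "s = t"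
    proof (rule PiE_ext)
      show "s \<in> V \<rightarrow>\<^sub>E UNIV" "t \<in> V \<rightarrow>\<^sub>E UNIV"
        using empty.prems assms by (auto simp: states_def)
    qed (use empty.prems in blast)
    with empty.prems assms show ?case by simp
  next
    case (insert x D)
    let ?s = "s(x := t x)"
    have x: "x \<in> V" "s x \<noteq> t x" using insert.prems by auto
    have s: "s \<in> states V" using insert.prems assms by auto
    show ?case
    proof (cases "?s \<in> I")
      case True
      moreover have "D = {v \<in> V. ?s v \<noteq> t v}"
        using insert.hyps insert.prems by auto
      ultimately show ?thesis using insert.IH by blast
    next
      case False
      have "?s \<in> states V" using s x by (auto simp: states_def PiE_def extensional_def)
      then have "neighbors V s ?s"
        using s x by (auto simp: neighbors_def intro!: ex1I[of _ x])
      with False insert.prems show ?thesis by (auto simp: inner_boundary_def)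
    qed
  qed
  with assms show ?thesis by auto
qed

lemma restrict_fun_upd_state:
  assumes "s \<in> states V" "q \<notin> V"
  shows "restrict (s(q := b)) V = s"
  using assms by (auto simp: states_def PiE_def extensional_def restrict_def)

lemma fun_upd_mem_states_insert:
  assumes "s \<in> states V"
  shows "s(q := b) \<in> states (insert q V)"
  using assms by (auto simp: states_def PiE_def extensional_def)

lemma fun_upd_mem_lift_formula_iff:
  assumes "s \<in> states V" "q \<notin> V"
  shows "s(q := b) \<in> lift_formula V (insert q V) \<phi> \<longleftrightarrow> s \<in> \<phi>"
  using restrict_fun_upd_state[OF assms, of b] fun_upd_mem_states_insert[OF assms(1), of q b]
  by (simp only: lift_formula_def mem_Collect_eq simp_thms)

lemma neighbors_fun_upd:
  assumes "neighbors V s t" "q \<notin> V"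
  shows "neighbors (insert q V) (s(q := b)) (t(q := b))"
proof -
  have "(v \<in> insert q V \<and> (s(q := b)) v \<noteq> (t(q := b)) v) \<longleftrightarrow> (v \<in> V \<and> s v \<noteq> t v)" for v
    using assms(2) by auto
  with assms(1) show ?thesis
    unfolding neighbors_def by (simp only: fun_upd_mem_states_insert simp_thms)
qed

text \<open>The lifted formula ignores \<open>q\<close>, so a boundary state and its neighbor
  outside \<open>I\<close> can both be extended by the same \<open>b\<close>. The freedom to choose
  \<open>b\<close> is what the final contradiction exploits.\<close>

lemma inner_boundary_lift_formula:
  assumes "s \<in> inner_boundary V I" "q \<notin> V"
  shows "s(q := b) \<in> inner_boundary (insert q V) (lift_formula V (insert q V) I)"
proof -
  obtain t where t: "s \<in> I" "neighbors V s t" "t \<notin> I"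
    using assms(1) by (auto simp: inner_boundary_def)
  then have "s \<in> states V" "t \<in> states V" by (auto simp: neighbors_def)
  with t assms(2) show ?thesis
    by (auto simp: inner_boundary_def fun_upd_mem_lift_formula_iff
        intro!: exI[of _ "t(q := b)"] neighbors_fun_upd)
qed

lemma reach_le_subset:
  assumes "S \<subseteq> A" "\<And>s s'. (s, s') \<in> \<delta> \<Longrightarrow> s \<in> A \<Longrightarrow> s' \<in> A"
  shows "reach_le \<delta> k S \<subseteq> A"
proof -
  have "t \<in> A" if "(s, t) \<in> \<delta> ^^ j" "s \<in> S" for s t j
    using that by (induction j arbitrary: t) (use assms in auto)
  then show ?thesis by (auto simp: reach_le_def)
qed

theorem lemma8p1:
  fixes \<Sigma> :: "'v set" and q :: 'v and \<psi> I :: "'v formula"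
    and Init Bad Init_hat Bad_hat :: "'v formula"
    and \<delta> \<delta>_hat :: "'v formula2"
  assumes "transition_system \<Sigma> (Init, \<delta>, Bad)"
    and "q \<notin> \<Sigma>"
    and "\<psi> \<subseteq> states \<Sigma>"
    and "instrumentation \<Sigma> (Init, \<delta>, Bad) q \<psi> (Init_hat, \<delta>_hat, Bad_hat)"
    and "inductive_invariant \<Sigma> (Init, \<delta>, Bad) I"
  shows "\<forall>k. \<not> forwards_fenced (insert q \<Sigma>) k (Init_hat, \<delta>_hat, Bad_hat)
                (lift_formula \<Sigma> (insert q \<Sigma>) I)"
proof (intro allI notI)
  fix k
  assume "forwards_fenced (insert q \<Sigma>) k (Init_hat, \<delta>_hat, Bad_hat)
            (lift_formula \<Sigma> (insert q \<Sigma>) I)"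
  \<comment> \<open>Correctness of \<open>q\<close> holds initially and is preserved by each step
    from a state where it holds, whatever \<open>\<delta>_hat\<close> does elsewhere.\<close>
  moreover have "reach_le \<delta>_hat k Init_hat \<subseteq> captures \<Sigma> q \<psi>"
    using assms(4) by (intro reach_le_subset) auto
  ultimately have fenced:
    "inner_boundary (insert q \<Sigma>) (lift_formula \<Sigma> (insert q \<Sigma>) I) \<subseteq> captures \<Sigma> q \<psi>"
    by auto
  \<comment> \<open>\<open>I\<close> contains the nonempty \<open>Init\<close> and is disjoint from
    the nonempty \<open>Bad\<close>, which yields states inside and outside
    \<open>I\<close>.\<close>
  obtain s0 where "s0 \<in> I" using assms(1,5) by auto
  moreover obtain t0 where "t0 \<in> states \<Sigma>" "t0 \<notin> I"
    using assms(1,5) by simp blast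
  moreover have I: "finite \<Sigma>" "I \<subseteq> states \<Sigma>" using assms(1,5) by auto
  ultimately obtain s where s: "s \<in> inner_boundary \<Sigma> I"
    using inner_boundary_nonempty by blast
  with I have "s \<in> states \<Sigma>" by (auto simp: inner_boundary_def)
  \<comment> \<open>The value given to \<open>q\<close> is the negation of the truth value of
    \<open>\<psi>\<close> at \<open>s\<close>, so \<open>q\<close> is wrong in this state.\<close>
  then have "s(q := s \<notin> \<psi>) \<notin> captures \<Sigma> q \<psi>"
    using assms(2) by (simp add: captures_def fun_upd_mem_lift_formula_iff)
  with fenced inner_boundary_lift_formula[OF s assms(2)] show False by blast
qed

end
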